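(* The interior penalty term $\mathcal M^{(b,V)}$ added to the wall penalty in the conservative variables is entropy dissipative: at every wall node, for the numerical state $v$ (with $\rho>0$, $\mathcal T>0$) and any wall velocity $\mathcal U^{\text{wall}}$, with $$\mathcal M^{(b,V)}=-\beta\,\frac{f^{(V)}(v)+f^{(V)}(v^{(b,V)})}{2},\qquad\beta>0,$$ its contribution to the right-hand side of the semidiscrete entropy balance satisfies $w^\top\mathcal M^{(b,V)}\le0$.
   Context: Setting. The three-dimensional Eulerian model is $\partial_t q+\partial_{x_l}f^{(I)}_l=\partial_{x_l}(\nu\,\partial_{x_l}q)$ (sum over $l=1,2,3$), $q=(\rho,\rho\mathcal U_1,\rho\mathcal U_2,\rho\mathcal U_3,\rho\mathcal E)^\top$, with $f^{(I)}_l$ the compressible Euler fluxes, pressure $p=\rho R\mathcal T$, $\mathcal E=c_v\mathcal T+\frac12\|\mathcal U\|^2$, constants $c_v>0$, $R=c_p-c_v>0$, and $\nu=\alpha\mu/\rho$, $\mu>0$, $\alpha\in[1,\frac43]$. It is discretized by a collocated diagonal-norm SBP–SAT method on a unit cube element with a no-slip solid wall on a face whose normal is in the $x_i$ direction. In the balance for the discrete total entropy, a penalty added at wall nodes to the conservative-variable equation contributes on the right-hand side the sum over wall nodes of (positive quadrature weight) times $w^\top$(penalty). Primitive variables: $v=(\rho,\mathcal U_1,\mathcal U_2,\mathcal U_3,\mathcal T)^\top$. Entropy $\mathcal S=-\rho s$, $s=c_v\ln\mathcal T-R\ln\rho$ (up to an additive constant). Entropy variables: $w=w(v)=(d\mathcal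 S/dq)^\top=\left(c_p-s-\frac{\|\mathcal U\|^2}{2\mathcal T},\frac{\mathcal U_1}{\mathcal T},\frac{\mathcal U_2}{\mathcal T},\frac{\mathcal U_3}{\mathcal T},-\frac1{\mathcal T}\right)^\top$. $\frac{dq}{dw}(v)$ is the (symmetric positive-definite) Jacobian of $q$ with respect to $w$ at the state $v$. Manufactured viscous wall state: $$v^{(b,V)}=\left(\rho,\,-\mathcal U_1+2\mathcal U_1^{\text{wall}},\,-\mathcal U_2+2\mathcal U_2^{\text{wall}},\,-\mathcal U_3+2\mathcal U_3^{\text{wall}},\,\mathcal T\right)^\top,$$ where $\mathcal U^{\text{wall}}$ is the prescribed wall velocity. Let $\Delta w=w(v)-w(v^{(b,V)})$ be the jump in entropy variables in the wall-normal direction, and $$f^{(V)}(v)=\nu\,\tfrac{dq}{dw}(v)\,\Delta w,\qquad f^{(V)}(v^{(b,V)})=\nu\,\tfrac{dq}{dw}(v^{(b,V)})\,\Delta w .$$ ($\nu$ takes the same value at both states since they have the same density.) The positive constant $\beta$ (the penalty strength, scaled with the inverse element length in the normal direction) is unrelated to the viscosity. *)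

theory Defs
  imports "HOL-Analysis.Analysis"
begin

text \<open>
  A state is a vector in \<open>real ^ 5\<close>, in primitive variables
  \<open>v = (\<rho>, U1, U2, U3, T)\<close>.  In the index type \<open>5\<close> the numeral \<open>5\<close> is
  the residue \<open>0\<close>, so \<open>v $ 1, \<dots>, v $ 5\<close> are the five components in the order in which
  \<open>vector [_, _, _, _, _]\<close> lists them (lemma \<open>vector_5_nth\<close>).
  The gas constant is \<open>R = cp - cv\<close>, and \<open>s0\<close> is the arbitrary additive constant of the
  thermodynamic entropy.
\<close>

lemma exhaust_5:
  fixes x :: 5
  shows "x = 1 \<or> x = 2 \<or> x = 3 \<or> x = 4 \<or> x = 5"
proof (induct x)
  case (of_int z)
  then have "0 \<le> z" "z < 5" by simp_all
  then have "z = 0 \<or> z = 1 \<or> z = 2 \<or> z = 3 \<or> z = 4" by arith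
  then show ?case by auto
qed

lemma forall_5: "(\<forall>i::5. P i) \<longleftrightarrow> P 1 \<and> P 2 \<and> P 3 \<and> P 4 \<and> P 5"
  by (metis exhaust_5)

lemma UNIV_5: "UNIV = {1, 2, 3, 4, 5::5}"
  using exhaust_5 by auto

lemma sum_5: "sum f (UNIV :: 5 set) = f 1 + f 2 + f 3 + f 4 + f 5"
  unfolding UNIV_5 by (simp add: ac_simps)

lemma vector_5_nth [simp]:
  fixes a b c d e :: "'a::zero"
  shows "(vector [a, b, c, d, e] :: 'a ^ 5) $ 1 = a"
    and "(vector [a, b, c, d, e] :: 'a ^ 5) $ 2 = b"
    and "(vector [a, b, c, d, e] :: 'a ^ 5) $ 3 = c"
    and "(vector [a, b, c, d, e] :: 'a ^ 5) $ 4 = d"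
    and "(vector [a, b, c, d, e] :: 'a ^ 5) $ 5 = e"
  unfolding vector_def by simp_all

definition admissible :: "(real ^ 5) set" where
  "admissible = {v. v $ 1 > 0 \<and> v $ 5 > 0}"

definition velocity :: "real ^ 5 \<Rightarrow> real ^ 3" where
  "velocity v = vector [v $ 2, v $ 3, v $ 4]"

definition specific_total_energy :: "real \<Rightarrow> real ^ 5 \<Rightarrow> real" where
  "specific_total_energy cv v = cv * v $ 5 + (norm (velocity v))\<^sup>2 / 2"

definition conservative_vars :: "real \<Rightarrow> real ^ 5 \<Rightarrow> real ^ 5" where
  "conservative_vars cv v =
     vector [v $ 1, v $ 1 * v $ 2, v $ 1 * v $ 3, v $ 1 * v $ 4,
             v $ 1 * specific_total_energy cv v]"

definition thermodynamic_entropy :: "real \<Rightarrow> real \<Rightarrow> real \<Rightarrow> real ^ 5 \<Rightarrow> real" where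
  "thermodynamic_entropy cv cp s0 v = cv * ln (v $ 5) - (cp - cv) * ln (v $ 1) + s0"

definition entropy :: "real \<Rightarrow> real \<Rightarrow> real \<Rightarrow> real ^ 5 \<Rightarrow> real" where
  "entropy cv cp s0 v = - v $ 1 * thermodynamic_entropy cv cp s0 v"

definition entropy_vars :: "real \<Rightarrow> real \<Rightarrow> real \<Rightarrow> real ^ 5 \<Rightarrow> real ^ 5" where
  "entropy_vars cv cp s0 v =
     vector [cp - thermodynamic_entropy cv cp s0 v - (norm (velocity v))\<^sup>2 / (2 * v $ 5),
             v $ 2 / v $ 5, v $ 3 / v $ 5, v $ 4 / v $ 5, - 1 / v $ 5]"

text \<open>
  The Jacobian \<open>dq/dw\<close> at the primitive state \<open>v\<close>: the derivative, at the point \<open>w(v)\<close>, of the map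
  sending entropy variables to conservative variables.  On \<open>admissible\<close> the map \<open>w\<close> is injective
  (lemma \<open>inj_on_entropy_vars\<close>), and \<open>w(admissible)\<close> is the open half space in which the last
  component is negative (lemma \<open>entropy_vars_image\<close>).
\<close>

definition dq_dw :: "real \<Rightarrow> real \<Rightarrow> real \<Rightarrow> real ^ 5 \<Rightarrow> real ^ 5 ^ 5" where
  "dq_dw cv cp s0 v =
     jacobian (conservative_vars cv \<circ> inv_into admissible (entropy_vars cv cp s0))
       (at (entropy_vars cv cp s0 v))"

definition viscosity :: "real \<Rightarrow> real \<Rightarrow> real ^ 5 \<Rightarrow> real" where
  "viscosity \<alpha> \<mu> v = \<alpha> * \<mu> / v $ 1"

definition viscous_wall_state :: "real ^ 3 \<Rightarrow> real ^ 5 \<Rightarrow> real ^ 5" where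
  "viscous_wall_state Uwall v =
     vector [v $ 1, - v $ 2 + 2 * Uwall $ 1, - v $ 3 + 2 * Uwall $ 2, - v $ 4 + 2 * Uwall $ 3,
             v $ 5]"

definition entropy_jump :: "real \<Rightarrow> real \<Rightarrow> real \<Rightarrow> real ^ 3 \<Rightarrow> real ^ 5 \<Rightarrow> real ^ 5" where
  "entropy_jump cv cp s0 Uwall v =
     entropy_vars cv cp s0 v - entropy_vars cv cp s0 (viscous_wall_state Uwall v)"

definition viscous_flux ::
    "real \<Rightarrow> real \<Rightarrow> real \<Rightarrow> real \<Rightarrow> real \<Rightarrow> real ^ 5 \<Rightarrow> real ^ 5 \<Rightarrow> real ^ 5" where
  "viscous_flux cv cp s0 \<alpha> \<mu> dw u = viscosity \<alpha> \<mu> u *\<^sub>R (dq_dw cv cp s0 u *v dw)"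

definition interior_penalty ::
    "real \<Rightarrow> real \<Rightarrow> real \<Rightarrow> real \<Rightarrow> real \<Rightarrow> real \<Rightarrow> real ^ 3 \<Rightarrow> real ^ 5 \<Rightarrow> real ^ 5" where
  "interior_penalty cv cp s0 \<alpha> \<mu> \<beta> Uwall v =
     (let dw = entropy_jump cv cp s0 Uwall v in
      (- \<beta>) *\<^sub>R ((viscous_flux cv cp s0 \<alpha> \<mu> dw v
                  + viscous_flux cv cp s0 \<alpha> \<mu> dw (viscous_wall_state Uwall v)) /\<^sub>R 2))"

lemma velocity_norm2: "(norm (velocity v))\<^sup>2 = (v $ 2)\<^sup>2 + (v $ 3)\<^sup>2 + (v $ 4)\<^sup>2"
  by (simp add: velocity_def norm_vec_def L2_set_def sum_3)

lemma inj_on_entropy_vars: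
  assumes "cv < cp"
  shows "inj_on (entropy_vars cv cp s0) admissible"
proof (rule inj_onI)
  fix x y assume x: "x \<in> admissible" and y: "y \<in> admissible"
    and eq: "entropy_vars cv cp s0 x = entropy_vars cv cp s0 y"
  have c: "entropy_vars cv cp s0 x $ i = entropy_vars cv cp s0 y $ i" for i using eq by simp
  have p: "x $ 1 > 0" "y $ 1 > 0" "x $ 5 > 0" "y $ 5 > 0"
    using x y by (auto simp: admissible_def)
  have 5: "x $ 5 = y $ 5" using c[of 5] p by (simp add: entropy_vars_def)
  have 2: "x $ 2 = y $ 2" "x $ 3 = y $ 3" "x $ 4 = y $ 4"
    using c[of 2] c[of 3] c[of 4] p 5 by (simp_all add: entropy_vars_def)
  have "(cp - cv) * ln (x $ 1) = (cp - cv) * ln (y $ 1)"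
    using c[of 1] 2 5 by (simp add: entropy_vars_def thermodynamic_entropy_def velocity_norm2)
  then have "x $ 1 = y $ 1" using assms p by simp
  with 2 5 show "x = y" by (simp add: vec_eq_iff forall_5)
qed

lemma entropy_vars_image:
  assumes "cv < cp"
  shows "entropy_vars cv cp s0 ` admissible = {w. w $ 5 < 0}"
proof (intro equalityI subsetI)
  fix w assume "w \<in> entropy_vars cv cp s0 ` admissible"
  then show "w \<in> {w. w $ 5 < 0}"
    by (auto simp: admissible_def entropy_vars_def)
next
  fix w :: "real ^ 5" assume "w \<in> {w. w $ 5 < 0}"
  then have w: "w $ 5 < 0" by simp
  define T where "T = - 1 / w $ 5"
  have T: "T > 0" using w by (simp add: T_def divide_simps)
  define \<rho> where "\<rho> = exp ((w $ 1 - cp + cv * ln T + s0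
      + ((T * w $ 2)\<^sup>2 + (T * w $ 3)\<^sup>2 + (T * w $ 4)\<^sup>2) / (2 * T)) / (cp - cv))"
  define v :: "real ^ 5" where "v = vector [\<rho>, T * w $ 2, T * w $ 3, T * w $ 4, T]"
  have "\<rho> > 0" by (simp add: \<rho>_def)
  then have "v \<in> admissible" using T by (simp add: admissible_def v_def)
  moreover have "(cp - cv) * ln \<rho> = w $ 1 - cp + cv * ln T + s0
      + ((T * w $ 2)\<^sup>2 + (T * w $ 3)\<^sup>2 + (T * w $ 4)\<^sup>2) / (2 * T)"
    using assms by (simp add: \<rho>_def)
  then have "entropy_vars cv cp s0 v = w"
    using T w by (simp add: vec_eq_iff forall_5 entropy_vars_def thermodynamic_entropy_def
        velocity_norm2 v_def) (simp add: T_def)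
  ultimately show "w \<in> entropy_vars cv cp s0 ` admissible" by blast
qed

text \<open>
  By the chain rule \<open>dS = w \<bullet> dq\<close>, that is \<open>w = (dS/dq)^T\<close>: the entropy variables are the gradient
  of the entropy with respect to the conservative variables.
\<close>

lemma entropy_vars_eq_entropy_gradient:
  assumes "v \<in> admissible"
  shows "(entropy cv cp s0 has_derivative
           (\<lambda>h. entropy_vars cv cp s0 v \<bullet> (jacobian (conservative_vars cv) (at v) *v h))) (at v)"
proof -
  have p: "v $ 1 > 0" "v $ 5 > 0" using assms by (auto simp: admissible_def)
  define D :: "real ^ 5 \<Rightarrow> real ^ 5" where
    "D h = vector [h $ 1, v $ 1 * h $ 2 + h $ 1 * v $ 2, v $ 1 * h $ 3 + h $ 1 * v $ 3,
       v $ 1 * h $ 4 + h $ 1 * v $ 4,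
       v $ 1 * (cv * h $ 5 + v $ 2 * h $ 2 + v $ 3 * h $ 3 + v $ 4 * h $ 4)
         + h $ 1 * specific_total_energy cv v]" for h
  have nth: "((\<lambda>x. x $ i) has_derivative (\<lambda>h. h $ i)) (at v)" for i :: 5
    by (intro bounded_linear.has_derivative[OF bounded_linear_vec_nth] has_derivative_ident)
  have "((\<lambda>x. conservative_vars cv x $ i) has_derivative (\<lambda>h. D h $ i)) (at v)" for i
  proof -
    have "\<forall>i. ((\<lambda>x. conservative_vars cv x $ i) has_derivative (\<lambda>h. D h $ i)) (at v)"
      unfolding forall_5 D_def conservative_vars_def specific_total_energy_def velocity_norm2 vector_5_nth
      by (intro conjI; (rule has_derivative_eq_rhs, (rule derivative_intros nth)+)?)
         (auto simp: fun_eq_iff algebra_simps power2_eq_square add_divide_distrib)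
    then show ?thesis by blast
  qed
  then have d: "(conservative_vars cv has_derivative D) (at v)"
    by (subst has_derivative_componentwise_within)
       (auto simp: Basis_vec_def inner_axis)
  then have "jacobian (conservative_vars cv) (at v) *v h = D h" for h
    using jacobian_works[of "conservative_vars cv" "at v"]
    by (metis differentiableI has_derivative_unique)
  moreover have "(entropy cv cp s0 has_derivative (\<lambda>h. entropy_vars cv cp s0 v \<bullet> D h)) (at v)"
    unfolding entropy_def[abs_def] thermodynamic_entropy_def
    by (rule has_derivative_eq_rhs, (rule derivative_intros nth p)+)
       (use p in \<open>auto simp: fun_eq_iff inner_vec_def sum_5 D_def entropy_vars_def
         thermodynamic_entropy_def specific_total_energy_def velocity_norm2[unfolded power2_eq_square] field_simps power2_eq_square\<close>)
  ultimately show ?thesis by simp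
qed

end

theory Submission
  imports Defs
begin

text \<open>
  Write \<open>d = U - Uwall\<close> for the slip velocity and \<open>R = cp - cv\<close>, and let \<open>v'\<close> be the manufactured
  wall state.  The jump \<open>\<Delta>w\<close> of the entropy variables between \<open>v\<close> and \<open>v'\<close> is in general not
  aligned with \<open>w(v)\<close>, so positive definiteness of \<open>dq/dw\<close> at the two states does not by itself give
  a sign.  What decides is how \<open>dq/dw(v)\<close> and \<open>dq/dw(v')\<close> combine.

  Since \<open>v\<close> and \<open>v'\<close> share \<open>\<rho>\<close> and \<open>T\<close> and have velocities \<open>Uwall \<plusminus> d\<close>, the jump is
  \<open>\<Delta>w = (2 / T) (- d \<bullet> Uwall, d, 0)\<close>.  Read as an infinitesimal change of state, it is the same
  velocity increment \<open>2 d\<close> and the same temperature increment \<open>0\<close> at both states, but opposite density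
  increments \<open>\<plusminus> r\<close> with \<open>r = 2 \<rho> |d|\<^sup>2 / (R T)\<close>.  When the increments of the conservative variables
  are added, the mass changes cancel, and what is left is
  \<open>(4 \<rho> + 2 r) (0, d, d \<bullet> Uwall)\<close> (lemma \<open>dq_dw_sum_entropy_jump\<close>).  Pairing this with \<open>w(v)\<close>,
  whose last four components are \<open>U / T\<close> and \<open>- 1 / T\<close>, gives
  \<open>(4 \<rho> + 2 r) (U \<bullet> d - Uwall \<bullet> d) / T = (4 \<rho> + 2 r) |d|\<^sup>2 / T\<close>: the energy component is exactly
  what turns the velocity \<open>U\<close> into the slip velocity, which is how a moving wall is accounted for.
  Hence the dissipation is explicit, and nonnegative
  (lemma \<open>entropy_vars_inner_interior_penalty\<close>).

  The Jacobian \<open>dq/dw\<close> is the derivative of a composition with the inverse of the map \<open>w\<close>.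
  By the inverse function theorem that inverse has as derivative the inverse of the linear map
  \<open>dw/dv\<close>, so that \<open>dq/dw = dq/dv (dw/dv)\<^sup>-\<^sup>1\<close> (lemma \<open>dq_dw_mult_vec\<close>), which is evaluated only in the
  direction of \<open>\<Delta>w\<close>.
\<close>

section \<open>Derivatives of the conservative and of the entropy variables\<close>

definition conservative_vars_deriv :: "real \<Rightarrow> real ^ 5 \<Rightarrow> real ^ 5 \<Rightarrow> real ^ 5" where
  "conservative_vars_deriv cv v h =
     vector [h $ 1, v $ 1 * h $ 2 + h $ 1 * v $ 2, v $ 1 * h $ 3 + h $ 1 * v $ 3,
       v $ 1 * h $ 4 + h $ 1 * v $ 4,
       v $ 1 * (cv * h $ 5 + velocity v \<bullet> velocity h) + h $ 1 * specific_total_energy cv v]"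

definition entropy_vars_deriv :: "real \<Rightarrow> real \<Rightarrow> real ^ 5 \<Rightarrow> real ^ 5 \<Rightarrow> real ^ 5" where
  "entropy_vars_deriv cv cp v h =
     vector [(cp - cv) * h $ 1 / v $ 1 - cv * h $ 5 / v $ 5 - velocity v \<bullet> velocity h / v $ 5
               + (norm (velocity v))\<^sup>2 * h $ 5 / (2 * (v $ 5)\<^sup>2),
       h $ 2 / v $ 5 - v $ 2 * h $ 5 / (v $ 5)\<^sup>2, h $ 3 / v $ 5 - v $ 3 * h $ 5 / (v $ 5)\<^sup>2,
       h $ 4 / v $ 5 - v $ 4 * h $ 5 / (v $ 5)\<^sup>2, h $ 5 / (v $ 5)\<^sup>2]"

text \<open>
  The formula comes from solving \<open>entropy_vars_deriv cv cp v h = k\<close> for \<open>h\<close> by back substitution: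
  the last component of \<open>k\<close> gives the temperature increment, the middle three then give the velocity
  increment, and the first one is left to determine the density increment.
\<close>

definition primitive_increment :: "real \<Rightarrow> real \<Rightarrow> real ^ 5 \<Rightarrow> real ^ 5 \<Rightarrow> real ^ 5" where
  "primitive_increment cv cp v k =
     vector [v $ 1 / (cp - cv) * (k $ 1 + cv * v $ 5 * k $ 5 + velocity v \<bullet> velocity k
               + (norm (velocity v))\<^sup>2 * k $ 5 / 2),
       v $ 5 * (k $ 2 + v $ 2 * k $ 5), v $ 5 * (k $ 3 + v $ 3 * k $ 5),
       v $ 5 * (k $ 4 + v $ 4 * k $ 5), (v $ 5)\<^sup>2 * k $ 5]"

lemma velocity_inner: "velocity u \<bullet> velocity v = u $ 2 * v $ 2 + u $ 3 * v $ 3 + u $ 4 * v $ 4"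
  by (simp add: velocity_def inner_vec_def sum_3)

lemma has_derivative_vec_nth_self: "((\<lambda>x. x $ i) has_derivative (\<lambda>h. h $ i)) (at v)"
  for v :: "real ^ 'n"
  by (intro bounded_linear.has_derivative[OF bounded_linear_vec_nth] has_derivative_ident)

lemma has_derivative_vecI:
  fixes f :: "'a::real_normed_vector \<Rightarrow> real ^ 'n"
  assumes "\<forall>i. ((\<lambda>x. f x $ i) has_derivative (\<lambda>h. f' h $ i)) (at v)"
  shows "(f has_derivative f') (at v)"
  using assms by (subst has_derivative_componentwise_within) (auto simp: Basis_vec_def inner_axis)

lemma conservative_vars_has_derivative:
  "(conservative_vars cv has_derivative conservative_vars_deriv cv v) (at v)"
proof (rule has_derivative_vecI)
  show "\<forall>i. ((\<lambda>x. conservative_vars cv x $ i) has_derivative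
               (\<lambda>h. conservative_vars_deriv cv v h $ i)) (at v)"
    unfolding forall_5 conservative_vars_deriv_def conservative_vars_def
      specific_total_energy_def velocity_norm2 velocity_inner vector_5_nth
    by (intro conjI;
        (rule has_derivative_eq_rhs, (rule derivative_intros has_derivative_vec_nth_self)+)?)
       (auto simp: fun_eq_iff algebra_simps power2_eq_square add_divide_distrib)
qed

lemma entropy_vars_has_derivative:
  assumes "v \<in> admissible"
  shows "(entropy_vars cv cp s0 has_derivative entropy_vars_deriv cv cp v) (at v)"
proof (rule has_derivative_vecI)
  have p: "v $ 1 > 0" "v $ 5 > 0" using assms by (auto simp: admissible_def)
  then have nz: "v $ 5 \<noteq> 0" "2 * v $ 5 \<noteq> 0" by auto
  show "\<forall>i. ((\<lambda>x. entropy_vars cv cp s0 x $ i) has_derivative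
               (\<lambda>h. entropy_vars_deriv cv cp v h $ i)) (at v)"
    unfolding forall_5 entropy_vars_deriv_def entropy_vars_def thermodynamic_entropy_def
      velocity_norm2 velocity_inner vector_5_nth
    by (intro conjI;
        (rule has_derivative_eq_rhs, (rule derivative_intros has_derivative_vec_nth_self p nz)+))
       (use p in \<open>auto simp: fun_eq_iff field_simps power2_eq_square\<close>)
qed

lemma entropy_vars_deriv_primitive_increment:
  assumes "v \<in> admissible" and "cv < cp"
  shows "entropy_vars_deriv cv cp v (primitive_increment cv cp v k) = k"
proof -
  have "v $ 1 > 0" "v $ 5 > 0" using assms by (auto simp: admissible_def)
  then show ?thesis
    using assms(2)
    unfolding vec_eq_iff forall_5 entropy_vars_deriv_def primitive_increment_def velocity_inner
      velocity_norm2 vector_5_nth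
    by (simp add: field_simps power2_eq_square)
qed

section \<open>The Jacobian of the conservative with respect to the entropy variables\<close>

lemma open_admissible: "open admissible"
  unfolding admissible_def by (intro open_Collect_conj open_Collect_less continuous_intros)

text \<open>
  On the open set \<open>admissible\<close> the map \<open>w\<close> is injective and continuous, and its derivative is
  invertible, so the local inverse is differentiable with the inverse derivative; the chain rule does
  the rest.
\<close>

lemma dq_dw_mult_vec:
  assumes "v \<in> admissible" and "cv < cp"
  shows "dq_dw cv cp s0 v *v k = conservative_vars_deriv cv v (primitive_increment cv cp v k)"
proof -
  let ?w = "entropy_vars cv cp s0"
  let ?g = "inv_into admissible ?w"
  have g: "?g (?w x) = x" if "x \<in> admissible" for x
    using that inj_on_entropy_vars[OF assms(2)] by (simp add: inv_into_f_f)
  have "(?g has_derivative primitive_increment cv cp v) (at (?w v))"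
  proof (rule has_derivative_inverse_strong[OF open_admissible assms(1)])
    show "continuous_on admissible ?w"
      using entropy_vars_has_derivative has_derivative_continuous
      by (blast intro: continuous_at_imp_continuous_on)
    show "(?w has_derivative entropy_vars_deriv cv cp v) (at v)"
      by (rule entropy_vars_has_derivative[OF assms(1)])
    show "entropy_vars_deriv cv cp v \<circ> primitive_increment cv cp v = id"
      using entropy_vars_deriv_primitive_increment[OF assms] by auto
  qed (use g in auto)
  then have "(conservative_vars cv \<circ> ?g has_derivative
      conservative_vars_deriv cv v \<circ> primitive_increment cv cp v) (at (?w v))"
    using conservative_vars_has_derivative[of cv v] g[OF assms(1)]
    by (intro diff_chain_at) auto
  then show ?thesis
    unfolding dq_dw_def
    by (metis comp_apply differentiableI has_derivative_unique jacobian_works)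
qed

section \<open>The penalty at a single wall node\<close>

lemma viscous_wall_state_admissible:
  "v \<in> admissible \<Longrightarrow> viscous_wall_state Uwall v \<in> admissible"
  by (simp add: admissible_def viscous_wall_state_def)

text \<open>
  Density and temperature agree at the two states, so the logarithms in the entropy cancel.  The
  difference of the kinetic energies is the product of the velocity difference \<open>2 d\<close> and the
  velocity sum \<open>2 Uwall\<close>.
\<close>

lemma entropy_jump_eq:
  assumes "v \<in> admissible"
  shows "entropy_jump cv cp s0 Uwall v =
     (2 / v $ 5) *\<^sub>R vector [- ((velocity v - Uwall) \<bullet> Uwall),
       v $ 2 - Uwall $ 1, v $ 3 - Uwall $ 2, v $ 4 - Uwall $ 3, 0]"
proof -
  have "v $ 5 \<noteq> 0" using assms by (auto simp: admissible_def)
  then show ?thesis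
    by (simp add: vec_eq_iff forall_5 entropy_jump_def entropy_vars_def viscous_wall_state_def
        thermodynamic_entropy_def velocity_norm2)
       (simp add: velocity_def inner_vec_def sum_3 field_simps power2_eq_square)
qed

text \<open>
  The single products \<open>dq/dw \<Delta>w\<close> contain a change of mass \<open>\<plusminus> r\<close>, and hence terms that have no sign
  when paired with \<open>w(v)\<close>.  In the sum the mass changes cancel and only the difference of what they
  carry survives: momentum \<open>r (U - U') = 2 r d\<close> and energy
  \<open>r (|U|\<^sup>2 - |U'|\<^sup>2) / 2 = 2 r (d \<bullet> Uwall)\<close>, with \<open>U'\<close> the velocity of the wall state.  These have the
  same direction as the contributions \<open>4 \<rho> d\<close> and \<open>4 \<rho> (d \<bullet> Uwall)\<close> of the velocity increments.
\<close>

lemma dq_dw_sum_entropy_jump: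
  fixes Uwall :: "real ^ 3"
  assumes "v \<in> admissible" and "cv < cp"
  defines "d \<equiv> velocity v - Uwall"
  shows "dq_dw cv cp s0 v *v entropy_jump cv cp s0 Uwall v
       + dq_dw cv cp s0 (viscous_wall_state Uwall v) *v entropy_jump cv cp s0 Uwall v
     = (4 * v $ 1 * (1 + (norm d)\<^sup>2 / ((cp - cv) * v $ 5)))
         *\<^sub>R vector [0, d $ 1, d $ 2, d $ 3, d \<bullet> Uwall]"
proof -
  have nz: "v $ 5 \<noteq> 0" "cp - cv \<noteq> 0" using assms by (auto simp: admissible_def)
  define e where "e = entropy_jump cv cp s0 Uwall v"
  \<comment> \<open>the density increment at \<open>v\<close>: for a fixed temperature, the first component of \<open>w\<close> changes by
    \<open>R \<delta>\<rho> / \<rho> - U \<bullet> \<delta>U / T\<close>, which is to be \<open>- 2 (d \<bullet> Uwall) / T\<close> for \<open>\<delta>U = 2 d\<close>\<close>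
  define r where "r = 2 * v $ 1 * (norm d)\<^sup>2 / ((cp - cv) * v $ 5)"
  have d: "d $ 1 = v $ 2 - Uwall $ 1" "d $ 2 = v $ 3 - Uwall $ 2" "d $ 3 = v $ 4 - Uwall $ 3"
    by (simp_all add: d_def velocity_def)
  have n: "(norm d)\<^sup>2 = (d $ 1)\<^sup>2 + (d $ 2)\<^sup>2 + (d $ 3)\<^sup>2"
    by (simp add: norm_vec_def L2_set_def sum_3)
  have i: "d \<bullet> Uwall = d $ 1 * Uwall $ 1 + d $ 2 * Uwall $ 2 + d $ 3 * Uwall $ 3"
    by (simp add: inner_vec_def sum_3)
  have e: "e = (2 / v $ 5) *\<^sub>R vector [- (d \<bullet> Uwall), d $ 1, d $ 2, d $ 3, 0]"
    unfolding e_def entropy_jump_eq[OF assms(1)] d d_def[symmetric] ..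
  have 1: "primitive_increment cv cp v e = vector [r, 2 * d $ 1, 2 * d $ 2, 2 * d $ 3, 0]"
    using nz unfolding vec_eq_iff forall_5 primitive_increment_def e vector_5_nth velocity_inner
    by (simp add: r_def n i) (simp add: d field_simps power2_eq_square)
  have 2: "primitive_increment cv cp (viscous_wall_state Uwall v) e
      = vector [- r, 2 * d $ 1, 2 * d $ 2, 2 * d $ 3, 0]"
    using nz unfolding vec_eq_iff forall_5 primitive_increment_def e vector_5_nth velocity_inner
    by (simp add: r_def n i viscous_wall_state_def) (simp add: d field_simps power2_eq_square)
  have c: "4 * v $ 1 * (1 + (norm d)\<^sup>2 / ((cp - cv) * v $ 5)) = 4 * v $ 1 + 2 * r"
    by (simp add: r_def algebra_simps)
  show ?thesis
    unfolding e_def[symmetric] dq_dw_mult_vec[OF assms(1,2)] c 1 2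
      dq_dw_mult_vec[OF viscous_wall_state_admissible[OF assms(1)] assms(2)]
    by (simp add: vec_eq_iff forall_5 conservative_vars_deriv_def viscous_wall_state_def
        specific_total_energy_def velocity_norm2 velocity_inner i d)
       (simp add: field_simps power2_eq_square)
qed

text \<open>
  The dissipation rate at a node is the squared slip times a factor with the sign of \<open>\<alpha> \<beta> \<mu>\<close>, so it
  vanishes precisely when the no-slip condition holds (for positive \<open>\<alpha>\<close>, \<open>\<beta>\<close> and \<open>\<mu>\<close>).  The density drops out because it
  scales the conservative increments while the viscosity is proportional to its inverse.
\<close>

lemma entropy_vars_inner_interior_penalty:
  fixes Uwall :: "real ^ 3"
  assumes "v \<in> admissible" and "cv < cp"
  defines "d \<equiv> velocity v - Uwall"
  shows "entropy_vars cv cp s0 v \<bullet> interior_penalty cv cp s0 \<alpha> \<mu> \<beta> Uwall v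
     = - (2 * \<beta> * \<alpha> * \<mu> / v $ 5 * (1 + (norm d)\<^sup>2 / ((cp - cv) * v $ 5)) * (norm d)\<^sup>2)"
proof -
  have p: "v $ 1 > 0" "v $ 5 > 0" using assms by (auto simp: admissible_def)
  define C where "C = 1 + (norm d)\<^sup>2 / ((cp - cv) * v $ 5)"
  define m :: "real ^ 5" where "m = vector [0, d $ 1, d $ 2, d $ 3, d \<bullet> Uwall]"
  have "viscosity \<alpha> \<mu> (viscous_wall_state Uwall v) = viscosity \<alpha> \<mu> v"
    by (simp add: viscosity_def viscous_wall_state_def)
  then have "interior_penalty cv cp s0 \<alpha> \<mu> \<beta> Uwall v
      = (- (\<beta> * viscosity \<alpha> \<mu> v / 2)) *\<^sub>R ((4 * v $ 1 * C) *\<^sub>R m)"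
    unfolding C_def m_def d_def dq_dw_sum_entropy_jump[OF assms(1,2), symmetric, of _ s0]
    by (simp add: interior_penalty_def Let_def viscous_flux_def scaleR_right_distrib)
  also have "\<dots> = (- (2 * \<beta> * \<alpha> * \<mu> * C)) *\<^sub>R m"
    using p by (simp add: viscosity_def)
  also have "entropy_vars cv cp s0 v \<bullet> \<dots> = - (2 * \<beta> * \<alpha> * \<mu> * C) * (entropy_vars cv cp s0 v \<bullet> m)"
    by simp
  also have "entropy_vars cv cp s0 v \<bullet> m = (velocity v \<bullet> d - Uwall \<bullet> d) / v $ 5"
    by (simp add: m_def entropy_vars_def velocity_def inner_vec_def sum_5 sum_3
        add_divide_distrib diff_divide_distrib algebra_simps)
  also have "velocity v \<bullet> d - Uwall \<bullet> d = (norm d)\<^sup>2"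
    by (simp add: d_def power2_norm_eq_inner inner_diff_left)
  finally show ?thesis by (simp add: C_def)
qed

theorem theorem6:
  fixes cv cp s0 \<alpha> \<mu> \<beta> :: real
    and wall_nodes :: "'n set" and weight :: "'n \<Rightarrow> real"
    and v :: "'n \<Rightarrow> real ^ 5" and Uwall :: "'n \<Rightarrow> real ^ 3"
  assumes "cv > 0" and "cp - cv > 0"
    and "\<mu> > 0" and "1 \<le> \<alpha>" and "\<alpha> \<le> 4 / 3" and "\<beta> > 0"
    and "finite wall_nodes"
    and "\<And>k. k \<in> wall_nodes \<Longrightarrow> weight k > 0"
    and "\<And>k. k \<in> wall_nodes \<Longrightarrow> v k $ 1 > 0"
    and "\<And>k. k \<in> wall_nodes \<Longrightarrow> v k $ 5 > 0"
  shows "(\<forall>k\<in>wall_nodes.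
            entropy_vars cv cp s0 (v k) \<bullet> interior_penalty cv cp s0 \<alpha> \<mu> \<beta> (Uwall k) (v k) \<le> 0)
       \<and> (\<Sum>k\<in>wall_nodes. weight k *
            (entropy_vars cv cp s0 (v k) \<bullet> interior_penalty cv cp s0 \<alpha> \<mu> \<beta> (Uwall k) (v k))) \<le> 0"
proof -
  have node: "entropy_vars cv cp s0 (v k) \<bullet> interior_penalty cv cp s0 \<alpha> \<mu> \<beta> (Uwall k) (v k) \<le> 0"
    if k: "k \<in> wall_nodes" for k
  proof -
    have "v k \<in> admissible" "cv < cp" and "0 < v k $ 5"
      using assms k by (auto simp: admissible_def)
    then show ?thesis
      using assms(2-6) by (simp add: entropy_vars_inner_interior_penalty)
  qed
  have "weight k *
      (entropy_vars cv cp s0 (v k) \<bullet> interior_penalty cv cp s0 \<alpha> \<mu> \<beta> (Uwall k) (v k)) \<le> 0"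
    if "k \<in> wall_nodes" for k
    using node[OF that] assms(8)[OF that] by (simp add: mult_nonneg_nonpos)
  with node show ?thesis by (simp add: sum_nonpos)
qed

end
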